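(* Let $\kappa_1,\kappa_2>0$ and $\widetilde D>0$ be constants. Consider on $[0,T)\times\mathbb{T}^n$ the non-isothermal ideal gas model $$\partial_t\rho=\kappa_1\Delta(\rho\theta),\qquad \kappa_2\,\partial_t(\rho\theta)-\kappa_1(\kappa_1+\kappa_2)\nabla\cdot\big(\theta\nabla(\rho\theta)\big)=\nabla\cdot(\kappa_3\nabla\theta),$$ and assume that $(\rho,\theta)$ is a smooth solution pair on this domain, with positive density $\rho$ and positive initial temperature $\theta(0,\cdot)$. If the material conductivity $\kappa_3$ takes the form $$\kappa_3=\kappa_1\widetilde D\,\theta\rho,$$ then: **I.** The absolute temperature $\theta$ is positive on $[0,T)\times\mathbb{T}^n$. **II.** The density $\rho$ is bounded from above unconditionally. **III.** If the temperature $\theta(t,x)$ either blows up or goes to zero, then the density $\rho(t,x)$ must vanish. Precisely, $$\rho(t,x)\le\min\left\{\theta^{-c_1},\,\theta^{-c_2}\right\}$$ for some constants $c_1>0$, $c_2<0$ depending on $\kappa_1,\kappa_2,\widetilde D$.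
   Context: $\mathbb{T}^n$ is the $n$-dimensional torus (periodic boundary conditions). $\rho=\rho(t,x)$ is the density and $\theta=\theta(t,x)$ the absolute temperature of the fluid; $\nabla$, $\nabla\cdot$ and $\Delta$ act in the space variable $x$ only. The conductivity $\kappa_3$ is not a constant but the stated function of $(\rho,\theta)$.
   Formalization: In Part III the bound is ρ ≤ C·min{θ^{-c1}, θ^{-c2}} with a constant C>0 depending on κ1, κ2, D̃ and the initial data (not on T); without C it fails for the constant solution ρ=2, θ=1. *)

theory Defs
  imports "HOL-Analysis.Analysis"
begin

text \<open>
  \<open>C_k_on k f S\<close>: \<open>f\<close> is of class \<open>C\<^sup>k\<close> on \<open>S\<close>. Derivatives are taken within \<open>S\<close>, so at boundary
  points belonging to \<open>S\<close> they are one-sided. Meant for sets on which the derivative within \<open>S\<close> is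
  unique, e.g. convex sets with nonempty interior such as \<open>[0,T) \<times> \<real>\<^sup>n\<close>; there, in finite
  dimension, continuity of all directional derivatives is continuity of the derivative.
\<close>

primrec C_k_on :: "nat \<Rightarrow> ('a::euclidean_space \<Rightarrow> real) \<Rightarrow> 'a set \<Rightarrow> bool" where
  "C_k_on 0 f S \<longleftrightarrow> continuous_on S f"
| "C_k_on (Suc k) f S \<longleftrightarrow>
     (\<exists>f'. (\<forall>x\<in>S. (f has_derivative f' x) (at x within S)) \<and> (\<forall>v. C_k_on k (\<lambda>x. f' x v) S))"

definition smooth_on :: "('a::euclidean_space \<Rightarrow> real) \<Rightarrow> 'a set \<Rightarrow> bool" where
  "smooth_on f S \<longleftrightarrow> (\<forall>k. C_k_on k f S)"

definition partial :: "'n::finite \<Rightarrow> (real^'n \<Rightarrow> real) \<Rightarrow> real^'n \<Rightarrow> real" where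
  "partial i f x = frechet_derivative f (at x) (axis i 1)"

definition grad :: "(real^'n \<Rightarrow> real) \<Rightarrow> real^'n \<Rightarrow> real^'n" where
  "grad f x = (\<chi> i. partial i f x)"

definition divergence :: "(real^'n \<Rightarrow> real^'n) \<Rightarrow> real^'n \<Rightarrow> real" where
  "divergence F x = (\<Sum>i\<in>UNIV. partial i (\<lambda>y. F y $ i) x)"

definition laplacian :: "(real^'n \<Rightarrow> real) \<Rightarrow> real^'n \<Rightarrow> real" where
  "laplacian f = divergence (grad f)"

text \<open>
  Functions on the torus \<open>\<real>\<^sup>n / \<int>\<^sup>n\<close> are functions on \<open>\<real>\<^sup>n\<close> with period 1 in each coordinate.
\<close>

definition torus_fun :: "(real^'n \<Rightarrow> 'b) \<Rightarrow> bool" where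
  "torus_fun f \<longleftrightarrow> (\<forall>x i. f (x + axis i 1) = f x)"

text \<open>Time derivative on \<open>[0,T)\<close>; one-sided at \<open>t = 0\<close>.\<close>

definition time_deriv :: "real \<Rightarrow> (real \<Rightarrow> 'a \<Rightarrow> real) \<Rightarrow> real \<Rightarrow> 'a \<Rightarrow> real" where
  "time_deriv T u t x = vector_derivative (\<lambda>s. u s x) (at t within {0..<T})"

definition smooth_on_torus :: "real \<Rightarrow> (real \<Rightarrow> real^'n \<Rightarrow> real) \<Rightarrow> bool" where
  "smooth_on_torus T u \<longleftrightarrow>
     (\<forall>t\<in>{0..<T}. torus_fun (u t)) \<and> smooth_on (\<lambda>(t, x). u t x) ({0..<T} \<times> UNIV)"

definition ideal_gas_solution ::
  "real \<Rightarrow> real \<Rightarrow> (real \<Rightarrow> real^'n \<Rightarrow> real) \<Rightarrow> real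
     \<Rightarrow> (real \<Rightarrow> real^'n \<Rightarrow> real) \<Rightarrow> (real \<Rightarrow> real^'n \<Rightarrow> real) \<Rightarrow> bool" where
  "ideal_gas_solution \<kappa>1 \<kappa>2 \<kappa>3 T \<rho> \<theta> \<longleftrightarrow>
     0 < T \<and> smooth_on_torus T \<rho> \<and> smooth_on_torus T \<theta> \<and>
     (\<forall>t\<in>{0..<T}. \<forall>x.
        time_deriv T \<rho> t x = \<kappa>1 * laplacian (\<lambda>y. \<rho> t y * \<theta> t y) x \<and>
        \<kappa>2 * time_deriv T (\<lambda>s y. \<rho> s y * \<theta> s y) t x
          - \<kappa>1 * (\<kappa>1 + \<kappa>2) *
              divergence (\<lambda>y. \<theta> t y *\<^sub>R grad (\<lambda>z. \<rho> t z * \<theta> t z) y) x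
          = divergence (\<lambda>y. \<kappa>3 t y *\<^sub>R grad (\<theta> t) y) x)"

text \<open>
  The solutions considered: conductivity \<open>\<kappa>3 = \<kappa>1 D \<theta> \<rho>\<close>, positive density, and temperature
  assumed positive at time \<open>0\<close> only.
\<close>

definition positive_gas_solution ::
  "real \<Rightarrow> real \<Rightarrow> real \<Rightarrow> real
     \<Rightarrow> (real \<Rightarrow> real^'n \<Rightarrow> real) \<Rightarrow> (real \<Rightarrow> real^'n \<Rightarrow> real) \<Rightarrow> bool" where
  "positive_gas_solution \<kappa>1 \<kappa>2 D T \<rho> \<theta> \<longleftrightarrow>
     ideal_gas_solution \<kappa>1 \<kappa>2 (\<lambda>t x. \<kappa>1 * D * \<theta> t x * \<rho> t x) T \<rho> \<theta> \<and>
     (\<forall>t\<in>{0..<T}. \<forall>x. 0 < \<rho> t x) \<and> (\<forall>x. 0 < \<theta> 0 x)"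

end

theory Submission
  imports Defs
begin

text \<open>
  Write \<open>a = ln \<rho>\<close> and \<open>b = ln \<theta>\<close>. The system is parabolic, and \<open>w = a + c b\<close> diagonalises its
  second-order part exactly when \<open>c\<close> is a root of \<open>\<kappa>1 c\<^sup>2 + (\<kappa>2 - \<kappa>1 - D) c - \<kappa>2\<close>, which has one
  root \<open>c1 > 1\<close> and one root \<open>c2 \<in> (-\<kappa>2/\<kappa>1, 0)\<close>. At a spatial maximum of \<open>w\<close> we have
  \<open>\<nabla>a = - c \<nabla>b\<close>, and the remaining first-order terms are then a nonpositive multiple of
  \<open>|\<nabla>b|\<^sup>2\<close>. By the maximum principle \<open>\<rho> \<theta>\<^sup>c\<close> is bounded by its initial maximum for both roots,
  which contains all the bounds on \<open>\<rho>\<close>. Positivity of \<open>\<theta>\<close> comes first: up to the first zero of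
  \<open>\<theta>\<close>, one has \<open>\<partial>\<^sub>t \<theta> \<ge> - K \<theta>\<close> at spatial minima, so that \<open>- exp (K t) \<theta>\<close> obeys the same
  maximum principle.
\<close>

section \<open>Periodic functions and the maximum principle on the torus\<close>

lemma torus_fun_shift_axis:
  assumes "torus_fun f"
  shows "f (x + of_int k *\<^sub>R axis i 1) = f x"
proof -
  have nat: "f (y + real m *\<^sub>R axis i 1) = f y" for m y
  proof (induction m)
    case (Suc m)
    have "f (y + real (Suc m) *\<^sub>R axis i 1) = f ((y + real m *\<^sub>R axis i 1) + axis i 1)"
      by (simp add: algebra_simps)
    also have "\<dots> = f (y + real m *\<^sub>R axis i 1)"
      using assms by (simp only: torus_fun_def)
    finally show ?case using Suc by simp
  qed simp
  show ?thesis
  proof (cases "k \<ge> 0")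
    case True
    then show ?thesis using nat[of x "nat k"] by simp
  next
    case False
    then show ?thesis using nat[of "x + of_int k *\<^sub>R axis i 1" "nat (- k)"] by simp
  qed
qed

text \<open>A point differs from its vector of fractional parts by an integer combination of the
  axis vectors, and the shifts can be removed one coordinate at a time. All values of a periodic
  function are thus taken on the compact unit cube.\<close>

lemma torus_fun_frac:
  fixes x :: "real^'n"
  assumes "torus_fun f"
  shows "f (\<chi> i. frac (x $ i)) = f x"
proof -
  have "f (y + (\<Sum>i\<in>A. of_int (k i) *\<^sub>R axis i 1)) = f y" if "finite A" for A k y
    using that
  proof (induction A arbitrary: y)
    case (insert a A)
    have "f (y + (\<Sum>i\<in>insert a A. of_int (k i) *\<^sub>R axis i 1))
        = f ((y + of_int (k a) *\<^sub>R axis a 1) + (\<Sum>i\<in>A. of_int (k i) *\<^sub>R axis i 1))"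
      using insert by (simp add: add.assoc)
    then show ?case
      using insert torus_fun_shift_axis[OF assms] by simp
  qed simp
  from this[of UNIV "\<chi> i. frac (x $ i)" "\<lambda>i. floor (x $ i)"]
  have "f ((\<chi> i. frac (x $ i)) + (\<Sum>i\<in>UNIV. of_int \<lfloor>x $ i\<rfloor> *\<^sub>R axis i 1)) = f (\<chi> i. frac (x $ i))"
    by simp
  moreover have "(\<chi> i. frac (x $ i)) + (\<Sum>i\<in>UNIV. of_int \<lfloor>x $ i\<rfloor> *\<^sub>R axis i 1) = x"
    by (simp add: vec_eq_iff axis_def frac_def if_distrib cong: if_cong)
  ultimately show ?thesis by simp
qed

lemma frac_vec_in_cbox: "(\<chi> i. frac (x $ i)) \<in> cbox 0 (1 :: real^'n)"
  by (simp add: mem_box_cart less_imp_le[OF frac_lt_1])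

text \<open>Compactness of the torus in terms of functions on the non-compact space: the maximum is
  taken over the time interval times the unit cube, and periodicity extends it to all
  points.\<close>

lemma torus_attains_sup:
  fixes u :: "real \<Rightarrow> real^'n \<Rightarrow> real"
  assumes per: "\<And>s. s \<in> {a..b} \<Longrightarrow> torus_fun (u s)"
    and cont: "continuous_on ({a..b} \<times> UNIV) (\<lambda>(s, x). u s x)"
    and "a \<le> b"
  obtains s x where "s \<in> {a..b}" "\<And>r y. r \<in> {a..b} \<Longrightarrow> u r y \<le> u s x"
proof -
  have "\<exists>z\<in>{a..b} \<times> cbox 0 (1 :: real^'n). \<forall>z'\<in>{a..b} \<times> cbox 0 1.
      (\<lambda>(s, x). u s x) z' \<le> (\<lambda>(s, x). u s x) z"
  proof (rule continuous_attains_sup)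
    show "compact ({a..b} \<times> cbox 0 (1 :: real^'n))" by (intro compact_Times compact_Icc compact_cbox)
    show "{a..b} \<times> cbox 0 (1 :: real^'n) \<noteq> {}"
      using \<open>a \<le> b\<close> frac_vec_in_cbox[of "0 :: real^'n"] by (auto simp: Sigma_empty_iff)
    show "continuous_on ({a..b} \<times> cbox 0 (1 :: real^'n)) (\<lambda>(s, x). u s x)"
      by (rule continuous_on_subset[OF cont]) auto
  qed
  then obtain s x where "s \<in> {a..b}" and max: "\<forall>r\<in>{a..b}. \<forall>y\<in>cbox 0 1. u r y \<le> u s x"
    by auto
  moreover have "u r y \<le> u s x" if "r \<in> {a..b}" for r y
    using max[rule_format, OF that frac_vec_in_cbox[of y]] torus_fun_frac[OF per[OF that], of y] by simp
  ultimately show ?thesis using that by blast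
qed

text \<open>
  Subtracting \<open>e * s\<close> with \<open>e > 0\<close> makes the derivative at a space-time maximum strictly
  negative, which is impossible unless the maximum is attained at time \<open>0\<close>.
\<close>

lemma torus_maximum_principle:
  fixes u u' :: "real \<Rightarrow> real^'n \<Rightarrow> real"
  assumes per: "\<And>s. s \<in> {0..b} \<Longrightarrow> torus_fun (u s)"
    and cont: "continuous_on ({0..b} \<times> UNIV) (\<lambda>(s, x). u s x)"
    and deriv: "\<And>s x. s \<in> {0..b} \<Longrightarrow>
      ((\<lambda>r. u r x) has_real_derivative u' s x) (at s within {0..b})"
    and at_max: "\<And>s x. s \<in> {0..b} \<Longrightarrow> (\<And>y. u s y \<le> u s x) \<Longrightarrow> u' s x \<le> 0"
    and init: "\<And>y. u 0 y \<le> m"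
    and t: "t \<in> {0..b}"
  shows "u t x \<le> m"
proof (rule field_le_epsilon)
  fix e :: real assume "e > 0"
  \<comment> \<open>The slope is chosen so that the perturbation \<open>d * s\<close> stays below
    \<open>e\<close> on \<open>[0, b]\<close>; the \<open>+ 1\<close> keeps the quotient meaningful
    for \<open>b = 0\<close>.\<close>
  define d where "d = e / (b + 1)"
  have "b \<ge> 0" using t by simp
  have "d > 0" using \<open>e > 0\<close> \<open>b \<ge> 0\<close> by (simp add: d_def)
  define v where "v = (\<lambda>s y. u s y - d * s)"
  have "torus_fun (v s)" if "s \<in> {0..b}" for s
    using per[OF that] by (simp add: torus_fun_def v_def)
  moreover have "continuous_on ({0..b} \<times> UNIV) (\<lambda>(s, x). v s x)"
    using cont by (auto simp: v_def case_prod_unfold intro!: continuous_intros)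
  ultimately obtain s z where s: "s \<in> {0..b}" and max: "\<And>r y. r \<in> {0..b} \<Longrightarrow> v r y \<le> v s z"
    using torus_attains_sup \<open>b \<ge> 0\<close> by blast
  have "s = 0"
  proof (rule ccontr)
    assume "s \<noteq> 0"
    then have "s > 0" using s by simp
    have "u s y \<le> u s z" for y using max[OF s, of y] by (simp add: v_def)
    then have "u' s z \<le> 0" using at_max s by blast
    have "((\<lambda>r. v r z) has_real_derivative u' s z - d) (at s within {0..b})"
      unfolding v_def by (auto intro!: derivative_eq_intros deriv[OF s])
    moreover have "u' s z - d < 0" using \<open>u' s z \<le> 0\<close> \<open>d > 0\<close> by simp
    ultimately obtain k where "k > 0" and
      k: "\<And>h. h > 0 \<Longrightarrow> s - h \<in> {0..b} \<Longrightarrow> h < k \<Longrightarrow> v s z < v (s - h) z"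
      using has_real_derivative_neg_dec_left by blast
    \<comment> \<open>A backward step below \<open>k\<close> that does not leave the interval; there
      \<open>v\<close> exceeds its maximum.\<close>
    define h where "h = min (k / 2) s"
    have "v s z < v (s - h) z" and "s - h \<in> {0..b}"
      using k[of h] \<open>k > 0\<close> \<open>s > 0\<close> s by (auto simp: h_def min_def)
    then show False using max[of "s - h" z] by simp
  qed
  then have "v t x \<le> m" using max[OF t, of x] init[of z] by (simp add: v_def)
  moreover have "d * t \<le> e"
  proof -
    have "d * t \<le> d * (b + 1)" using t \<open>d > 0\<close> by (intro mult_left_mono) auto
    then show ?thesis using \<open>b \<ge> 0\<close> by (simp add: d_def)
  qed
  ultimately show "u t x \<le> m + e" by (simp add: v_def)
qed

section \<open>Second derivative tests and the calculus of partial derivatives\<close>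

text \<open>If \<open>l\<close> were positive, \<open>\<phi>'\<close> would be positive just to the
  right of its zero \<open>a\<close>, and the mean value theorem would give a value of
  \<open>\<phi>\<close> above the maximum.\<close>

lemma second_derivative_test_max:
  fixes \<phi> \<phi>' :: "real \<Rightarrow> real"
  assumes d1: "\<And>s. (\<phi> has_real_derivative \<phi>' s) (at s)"
    and d2: "(\<phi>' has_real_derivative l) (at a)"
    and max: "\<And>s. \<phi> s \<le> \<phi> a"
  shows "\<phi>' a = 0" and "l \<le> 0"
proof -
  show zero: "\<phi>' a = 0"
    using DERIV_local_max[OF d1, of 1] max by simp
  show "l \<le> 0"
  proof (rule ccontr)
    assume "\<not> l \<le> 0"
    then obtain k where "k > 0" and k: "\<And>h. 0 < h \<Longrightarrow> h < k \<Longrightarrow> \<phi>' a < \<phi>' (a + h)"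
      using DERIV_pos_inc_right[OF d2] by auto
    obtain z where "a < z" "z < a + k / 2" "\<phi> (a + k / 2) - \<phi> a = (a + k / 2 - a) * \<phi>' z"
      using MVT2[of a "a + k / 2" \<phi> \<phi>'] d1 \<open>k > 0\<close> by auto
    moreover have "\<phi>' z > 0" using k[of "z - a"] zero \<open>a < z\<close> \<open>z < a + k / 2\<close> \<open>k > 0\<close> by simp
    ultimately have "\<phi> (a + k / 2) > \<phi> a" using \<open>k > 0\<close> by (smt (verit) mult_pos_pos)
    then show False using max[of "a + k / 2"] by simp
  qed
qed

text \<open>Exactly what is needed to apply the product rule twice and to differentiate restrictions
  to axis-parallel lines twice; the second partial derivatives may be discontinuous.\<close>

definition twice_differentiable :: "(real^'n::finite \<Rightarrow> real) \<Rightarrow> bool" where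
  "twice_differentiable f \<longleftrightarrow>
     (\<forall>x. f differentiable (at x)) \<and> (\<forall>i x. partial i f differentiable (at x))"

lemma partial_eqI: "(f has_derivative f') (at x) \<Longrightarrow> partial i f x = f' (axis i 1)"
  unfolding partial_def using frechet_derivative_at by metis

lemma has_derivative_frechet:
  "f differentiable (at x) \<Longrightarrow> (f has_derivative frechet_derivative f (at x)) (at x)"
  by (simp add: frechet_derivative_works)

lemma partial_mult:
  assumes "f differentiable (at x)" "g differentiable (at x)"
  shows "partial i (\<lambda>y. f y * g y) x = partial i f x * g x + f x * partial i g x"
  using partial_eqI[OF has_derivative_mult[OF assms[THEN has_derivative_frechet]], of i]
  by (simp add: partial_def)

lemma partial_add:
  assumes "f differentiable (at x)" "g differentiable (at x)"
  shows "partial i (\<lambda>y. f y + g y) x = partial i f x + partial i g x"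
  using partial_eqI[OF has_derivative_add[OF assms[THEN has_derivative_frechet]], of i]
  by (simp add: partial_def)

lemma twice_differentiable_mult:
  assumes "twice_differentiable f" "twice_differentiable g"
  shows "twice_differentiable (\<lambda>y. f y * g y)"
    and "partial i (partial i (\<lambda>y. f y * g y)) x
      = partial i (partial i f) x * g x + 2 * partial i f x * partial i g x
        + f x * partial i (partial i g) x"
proof -
  have 1: "partial j (\<lambda>y. f y * g y) = (\<lambda>x. partial j f x * g x + f x * partial j g x)" for j
    using assms by (intro ext partial_mult) (auto simp: twice_differentiable_def)
  then show "twice_differentiable (\<lambda>y. f y * g y)"
    using assms by (simp add: twice_differentiable_def)
  show "partial i (partial i (\<lambda>y. f y * g y)) x
      = partial i (partial i f) x * g x + 2 * partial i f x * partial i g x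
        + f x * partial i (partial i g) x"
    using assms by (simp add: 1 partial_add partial_mult twice_differentiable_def)
qed

lemma laplacian_eq_sum: "laplacian f x = (\<Sum>i\<in>UNIV. partial i (partial i f) x)"
  by (simp add: laplacian_def divergence_def grad_def)

lemma divergence_scaleR_grad:
  assumes "g differentiable (at x)" "twice_differentiable f"
  shows "divergence (\<lambda>y. g y *\<^sub>R grad f y) x
    = (\<Sum>i\<in>UNIV. partial i g x * partial i f x + g x * partial i (partial i f) x)"
  using assms by (simp add: divergence_def grad_def partial_mult twice_differentiable_def)

text \<open>The chain rule along an axis-parallel line, which reduces spatial extrema to
  one-variable calculus.\<close>

lemma has_derivative_along_axis:
  assumes "f differentiable (at (x + s *\<^sub>R axis i 1))"
  shows "((\<lambda>s. f (x + s *\<^sub>R axis i 1)) has_real_derivative partial i f (x + s *\<^sub>R axis i 1)) (at s)"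
proof -
  let ?D = "frechet_derivative f (at (x + s *\<^sub>R axis i 1))"
  have D: "(f has_derivative ?D) (at (x + s *\<^sub>R axis i 1))"
    using assms by (rule has_derivative_frechet)
  have "((\<lambda>s. x + s *\<^sub>R axis i 1) has_derivative (\<lambda>h. h *\<^sub>R axis i 1)) (at s)"
    by (auto intro!: derivative_eq_intros)
  from has_derivative_compose[OF this D]
  have "((\<lambda>s. f (x + s *\<^sub>R axis i 1)) has_derivative (\<lambda>h. ?D (h *\<^sub>R axis i 1))) (at s)" .
  moreover have "?D (h *\<^sub>R axis i 1) = partial i f (x + s *\<^sub>R axis i 1) * h" for h
    using linear_scale[OF has_derivative_linear[OF D]] by (simp add: partial_def)
  ultimately show ?thesis by (simp add: has_field_derivative_def)
qed

text \<open>The second derivative test on the line through \<open>x\<close> parallel to axis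
  \<open>i\<close>, where each logarithm \<open>ln h\<close> has derivatives \<open>h' / h\<close>
  and \<open>h'' / h - (h' / h)^2\<close>. Each coordinate is treated separately, so that the
  evolution equations can be estimated summand by summand.\<close>

lemma spatial_max_ln_add_ln:
  assumes f: "twice_differentiable f" "\<And>y. f y > 0"
    and g: "twice_differentiable g" "\<And>y. g y > 0"
    and max: "\<And>y. ln (f y) + c * ln (g y) \<le> ln (f x) + c * ln (g x)"
  shows "partial i f x / f x + c * (partial i g x / g x) = 0"
    and "partial i (partial i f) x / f x - (partial i f x / f x)\<^sup>2
      + c * (partial i (partial i g) x / g x - (partial i g x / g x)\<^sup>2) \<le> 0"
proof -
  define z where "z s = x + s *\<^sub>R axis i 1" for s :: real
  define \<phi> where "\<phi> s = ln (f (z s)) + c * ln (g (z s))" for s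
  define \<phi>' where "\<phi>' s = partial i f (z s) / f (z s) + c * (partial i g (z s) / g (z s))" for s
  have der: "((\<lambda>s. h (z s)) has_real_derivative partial i h (z s)) (at s)"
    if "twice_differentiable h" for h s
    using that unfolding z_def by (intro has_derivative_along_axis) (auto simp: twice_differentiable_def)
  have der': "((\<lambda>s. partial i h (z s)) has_real_derivative partial i (partial i h) (z s)) (at s)"
    if "twice_differentiable h" for h s
    using that unfolding z_def by (intro has_derivative_along_axis) (auto simp: twice_differentiable_def)
  have d1: "(\<phi> has_real_derivative \<phi>' s) (at s)" for s
    unfolding \<phi>_def \<phi>'_def
    by (auto intro!: derivative_eq_intros der f g simp: f(2) g(2) less_imp_neq[symmetric])
  have d2: "(\<phi>' has_real_derivative partial i (partial i f) x / f x - (partial i f x / f x)\<^sup>2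
      + c * (partial i (partial i g) x / g x - (partial i g x / g x)\<^sup>2)) (at 0)"
  proof -
    have quot: "((\<lambda>s. partial i h (z s) / h (z s)) has_real_derivative
        partial i (partial i h) x / h x - (partial i h x / h x)\<^sup>2) (at 0)"
      if h: "twice_differentiable h" "\<And>y. h y > 0" for h
    proof -
      have "h (z 0) \<noteq> 0" using h(2)[of "z 0"] by simp
      from DERIV_divide[OF der'[OF h(1)] der[OF h(1)] this]
      show ?thesis using h(2)[of x] by (simp add: z_def field_simps power2_eq_square)
    qed
    show ?thesis
      unfolding \<phi>'_def by (intro DERIV_add DERIV_cmult quot f g)
  qed
  have "\<phi> s \<le> \<phi> 0" for s using max by (simp add: \<phi>_def z_def)
  from second_derivative_test_max[OF d1 d2 this]
  show "partial i f x / f x + c * (partial i g x / g x) = 0"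
    and "partial i (partial i f) x / f x - (partial i f x / f x)\<^sup>2
      + c * (partial i (partial i g) x / g x - (partial i g x / g x)\<^sup>2) \<le> 0"
    by (simp_all add: \<phi>'_def z_def)
qed

lemma spatial_min:
  assumes "twice_differentiable g" and min: "\<And>y. g x \<le> g y"
  shows "partial i g x = 0" and "partial i (partial i g) x \<ge> 0"
proof -
  define z where "z s = x + s *\<^sub>R axis i 1" for s :: real
  have d1: "((\<lambda>s. - g (z s)) has_real_derivative - partial i g (z s)) (at s)" for s
    using assms(1) unfolding z_def
    by (intro DERIV_minus has_derivative_along_axis) (auto simp: twice_differentiable_def)
  have d2: "((\<lambda>s. - partial i g (z s)) has_real_derivative - partial i (partial i g) (z 0)) (at 0)"
    using assms(1) unfolding z_def
    by (intro DERIV_minus has_derivative_along_axis) (auto simp: twice_differentiable_def)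
  have "- g (z s) \<le> - g (z 0)" for s using min by (simp add: z_def)
  from second_derivative_test_max[OF d1 d2 this]
  show "partial i g x = 0" and "partial i (partial i g) x \<ge> 0" by (simp_all add: z_def)
qed

section \<open>From joint smoothness to pointwise evolution equations\<close>

text \<open>Smoothness is stated jointly in time and space, with derivatives within the slab,
  whereas the equations use separate time and space derivatives. These arise by composing with the
  embeddings of a time slice and of a time line into the slab.\<close>

lemma smooth_on_torusD:
  fixes u :: "real \<Rightarrow> real^'n \<Rightarrow> real"
  assumes u: "smooth_on_torus T u"
  shows "continuous_on ({0..<T} \<times> UNIV) (\<lambda>(t, x). u t x)"
    and "t \<in> {0..<T} \<Longrightarrow> twice_differentiable (u t)"
    and "t \<in> {0..<T} \<Longrightarrow>
      ((\<lambda>s. u s x) has_real_derivative time_deriv T u t x) (at t within {0..<T})"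
    and "continuous_on ({0..<T} \<times> UNIV) (\<lambda>(t, x). laplacian (u t) x)"
proof -
  let ?S = "{0..<T} \<times> (UNIV :: (real^'n) set)"
  let ?U = "\<lambda>(t, x). u t x"
  \<comment> \<open>Two derivatives suffice: \<open>U'\<close> is the derivative of
    \<open>u\<close>, and \<open>U'' v\<close> is the derivative of \<open>U'\<close> in the fixed
    direction \<open>v\<close>.\<close>
  have "C_k_on (Suc (Suc 0)) ?U ?S"
    using u unfolding smooth_on_torus_def smooth_on_def by blast
  then obtain U' where U': "\<And>z. z \<in> ?S \<Longrightarrow> (?U has_derivative U' z) (at z within ?S)"
    and "\<forall>v. \<exists>U''. (\<forall>z\<in>?S. ((\<lambda>z. U' z v) has_derivative U'' z) (at z within ?S))
      \<and> (\<forall>w. continuous_on ?S (\<lambda>z. U'' z w))"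
    by auto
  then obtain U'' where
    U'': "\<And>v z. z \<in> ?S \<Longrightarrow> ((\<lambda>z. U' z v) has_derivative U'' v z) (at z within ?S)"
    and cont: "\<And>v w. continuous_on ?S (\<lambda>z. U'' v z w)"
    by metis
  show "continuous_on ?S ?U"
    using U' has_derivative_continuous_on by blast
  \<comment> \<open>A whole slice \<open>{t} \<times> UNIV\<close> lies in the slab, so the spatial
    derivative is unrestricted even at \<open>t = 0\<close>.\<close>
  have space: "((\<lambda>y. f (t, y)) has_derivative (\<lambda>h. f' (0, h))) (at x)"
    if t: "t \<in> {0..<T}" and f: "(f has_derivative f') (at (t, x) within ?S)" for f f' t x
  proof -
    have "((\<lambda>y. (t, y)) has_derivative (\<lambda>h. (0, h))) (at x)"
      by (auto intro!: derivative_eq_intros)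
    moreover have "range (\<lambda>y. (t, y)) \<subseteq> ?S" using t by auto
    then have "(f has_derivative f') (at (t, x) within range (\<lambda>y. (t, y)))"
      using f has_derivative_subset by blast
    ultimately show ?thesis
      using has_derivative_in_compose by blast
  qed
  have d1: "(u t has_derivative (\<lambda>h. U' (t, x) (0, h))) (at x)" if "t \<in> {0..<T}" for t x
    using space[OF that U', of x] that by simp
  have p1: "partial i (u t) = (\<lambda>x. U' (t, x) (0, axis i 1))" if "t \<in> {0..<T}" for t i
    using partial_eqI[OF d1[OF that]] by blast
  have d2: "(partial i (u t) has_derivative (\<lambda>h. U'' (0, axis i 1) (t, x) (0, h))) (at x)"
    if "t \<in> {0..<T}" for t x i
    unfolding p1[OF that] using space[OF that U'', of x] that by simp
  show "twice_differentiable (u t)" if "t \<in> {0..<T}"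
    using d1[OF that] d2[OF that] unfolding twice_differentiable_def differentiable_def by blast
  have p2: "partial i (partial i (u t)) x = U'' (0, axis i 1) (t, x) (0, axis i 1)"
    if "t \<in> {0..<T}" for t x i
    by (rule partial_eqI[OF d2[OF that]])
  have "continuous_on ?S (\<lambda>z. \<Sum>i\<in>UNIV. U'' (0, axis i 1) z (0, axis i 1))"
    by (intro continuous_on_sum cont)
  then show "continuous_on ?S (\<lambda>(t, x). laplacian (u t) x)"
    by (rule continuous_on_cong[THEN iffD1, rotated 2]) (auto simp: laplacian_eq_sum p2)
  show "((\<lambda>s. u s x) has_real_derivative time_deriv T u t x) (at t within {0..<T})"
    if t: "t \<in> {0..<T}"
  proof -
    have "((\<lambda>s. (s, x)) has_derivative (\<lambda>h. (h, 0))) (at t within {0..<T})"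
      by (auto intro!: derivative_eq_intros)
    moreover have "(\<lambda>s. (s, x)) ` {0..<T} \<subseteq> ?S" by auto
    then have "(?U has_derivative U' (t, x)) (at (t, x) within (\<lambda>s. (s, x)) ` {0..<T})"
      using U' t has_derivative_subset by blast
    ultimately have "((\<lambda>s. ?U (s, x)) has_derivative (\<lambda>h. U' (t, x) (h, 0))) (at t within {0..<T})"
      using has_derivative_in_compose by blast
    then have "(\<lambda>s. u s x) differentiable (at t within {0..<T})"
      unfolding differentiable_def by auto
    then show ?thesis
      unfolding time_deriv_def has_real_derivative_iff_has_vector_derivative
      by (simp add: vector_derivative_works)
  qed
qed

text \<open>Every point of \<open>[0, T)\<close> is a limit point of that interval, so the
  derivative within it is unique, also at the left end.\<close>

lemma time_deriv_eqI:
  assumes "((\<lambda>s. u s x) has_real_derivative d) (at t within {0..<T})" "t \<in> {0..<T}"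
  shows "time_deriv T u t x = d"
proof -
  have "at t within {0..<T} \<noteq> bot"
    using assms(2) by (auto simp: trivial_limit_within islimpt_Ico)
  then show ?thesis
    using assms(1) unfolding time_deriv_def has_real_derivative_iff_has_vector_derivative
    by (rule vector_derivative_within)
qed

text \<open>Here \<open>q i\<close> and \<open>q' i\<close> are the first and second partial
  derivatives of the product of density and temperature. Expanding the time derivative of this
  product and inserting the mass equation turns the energy equation into one for
  \<open>\<theta>\<close> alone on the left, with the right-hand side split by coordinates.\<close>

lemma gas_evolution:
  fixes \<rho> \<theta> :: "real \<Rightarrow> real^'n \<Rightarrow> real" and x :: "real^'n"
  assumes sol: "positive_gas_solution \<kappa>1 \<kappa>2 D T \<rho> \<theta>" and t: "t \<in> {0..<T}"
  defines "q i \<equiv> partial i (\<rho> t) x * \<theta> t x + \<rho> t x * partial i (\<theta> t) x"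
    and "q' i \<equiv> partial i (partial i (\<rho> t)) x * \<theta> t x
      + 2 * partial i (\<rho> t) x * partial i (\<theta> t) x + \<rho> t x * partial i (partial i (\<theta> t)) x"
  shows "time_deriv T \<rho> t x = (\<Sum>i\<in>UNIV. \<kappa>1 * q' i)"
    and "\<kappa>2 * \<rho> t x * time_deriv T \<theta> t x =
      (\<Sum>i\<in>UNIV. \<kappa>1\<^sup>2 * \<theta> t x * q' i + \<kappa>1 * (\<kappa>1 + \<kappa>2 + D) * partial i (\<theta> t) x * q i
        + \<kappa>1 * D * \<rho> t x * \<theta> t x * partial i (partial i (\<theta> t)) x)"
proof -
  let ?p = "\<lambda>y. \<rho> t y * \<theta> t y"
  have smooth: "smooth_on_torus T \<rho>" "smooth_on_torus T \<theta>"
    and mass: "time_deriv T \<rho> t x = \<kappa>1 * laplacian ?p x"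
    and energy: "\<kappa>2 * time_deriv T (\<lambda>s y. \<rho> s y * \<theta> s y) t x
          - \<kappa>1 * (\<kappa>1 + \<kappa>2) * divergence (\<lambda>y. \<theta> t y *\<^sub>R grad ?p y) x
          = divergence (\<lambda>y. (\<kappa>1 * D * \<theta> t y * \<rho> t y) *\<^sub>R grad (\<theta> t) y) x"
    using sol t unfolding positive_gas_solution_def ideal_gas_solution_def by auto
  note td = smooth(1)[THEN smooth_on_torusD(2), OF t] smooth(2)[THEN smooth_on_torusD(2), OF t]
  note d = td[unfolded twice_differentiable_def, THEN conjunct1, THEN spec]
  have q: "partial i ?p x = q i" for i
    using d by (simp add: partial_mult q_def)
  have q': "partial i (partial i ?p) x = q' i" for i
    using td by (simp add: twice_differentiable_mult(2) q'_def)
  show \<rho>_t: "time_deriv T \<rho> t x = (\<Sum>i\<in>UNIV. \<kappa>1 * q' i)"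
    using mass by (simp add: laplacian_eq_sum q' sum_distrib_left)
  have "((\<lambda>s. \<rho> s x * \<theta> s x) has_real_derivative
      time_deriv T \<rho> t x * \<theta> t x + time_deriv T \<theta> t x * \<rho> t x) (at t within {0..<T})"
    by (intro DERIV_mult smooth_on_torusD(3) smooth t)
  then have p_t: "time_deriv T (\<lambda>s y. \<rho> s y * \<theta> s y) t x =
      time_deriv T \<rho> t x * \<theta> t x + time_deriv T \<theta> t x * \<rho> t x"
    using t by (rule time_deriv_eqI)
  \<comment> \<open>The conductivity is a constant multiple of the product, so its gradient is again
    expressed by \<open>q\<close>.\<close>
  have "partial i (\<lambda>y. (\<kappa>1 * D) * ?p y) x = (\<kappa>1 * D) * q i" for i
    using partial_mult[of "\<lambda>_. \<kappa>1 * D" x ?p i] d q[of i]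
      partial_eqI[OF has_derivative_const, of i "\<kappa>1 * D" x]
    by simp
  then have "partial i (\<lambda>y. \<kappa>1 * D * \<theta> t y * \<rho> t y) x = \<kappa>1 * D * q i" for i
    by (simp add: mult_ac)
  then have rhs: "divergence (\<lambda>y. (\<kappa>1 * D * \<theta> t y * \<rho> t y) *\<^sub>R grad (\<theta> t) y) x =
      (\<Sum>i\<in>UNIV. \<kappa>1 * D * q i * partial i (\<theta> t) x
        + \<kappa>1 * D * \<theta> t x * \<rho> t x * partial i (partial i (\<theta> t)) x)"
    using td d by (simp add: divergence_scaleR_grad)
  have lhs: "divergence (\<lambda>y. \<theta> t y *\<^sub>R grad ?p y) x =
      (\<Sum>i\<in>UNIV. partial i (\<theta> t) x * q i + \<theta> t x * q' i)"
    using td d by (simp add: divergence_scaleR_grad twice_differentiable_mult(1) q q')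
  \<comment> \<open>Removing the contribution of the mass equation lowers the coefficient of
    \<open>\<theta> * q'\<close> from \<open>\<kappa>1 * (\<kappa>1 + \<kappa>2)\<close> to
    \<open>\<kappa>1\<^sup>2\<close>.\<close>
  have "\<kappa>2 * \<rho> t x * time_deriv T \<theta> t x =
      \<kappa>1 * (\<kappa>1 + \<kappa>2) * (\<Sum>i\<in>UNIV. partial i (\<theta> t) x * q i + \<theta> t x * q' i)
      + (\<Sum>i\<in>UNIV. \<kappa>1 * D * q i * partial i (\<theta> t) x
        + \<kappa>1 * D * \<theta> t x * \<rho> t x * partial i (partial i (\<theta> t)) x)
      - \<kappa>2 * \<theta> t x * (\<Sum>i\<in>UNIV. \<kappa>1 * q' i)"
    using energy unfolding p_t lhs rhs \<rho>_t by (simp add: algebra_simps)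
  then show "\<kappa>2 * \<rho> t x * time_deriv T \<theta> t x =
      (\<Sum>i\<in>UNIV. \<kappa>1\<^sup>2 * \<theta> t x * q' i + \<kappa>1 * (\<kappa>1 + \<kappa>2 + D) * partial i (\<theta> t) x * q i
        + \<kappa>1 * D * \<rho> t x * \<theta> t x * partial i (partial i (\<theta> t)) x)"
    by (simp add: sum_distrib_left sum.distrib[symmetric] sum_subtractf[symmetric]
        algebra_simps power2_eq_square)
qed

section \<open>Positivity of the temperature\<close>

text \<open>Differentiation commutes with translations. This makes the Laplacian of the density
  periodic, so that a growth rate built from it is bounded on compact time intervals.\<close>

lemma torus_fun_partial:
  fixes f :: "real^'n \<Rightarrow> real"
  assumes "torus_fun f" "\<And>x. f differentiable (at x)"
  shows "torus_fun (partial i f)"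
  unfolding torus_fun_def
proof (intro allI)
  fix x :: "real^'n" and j :: 'n
  let ?a = "axis j 1 :: real^'n"
  have "((\<lambda>y. y + ?a) has_derivative (\<lambda>h. h)) (at x)"
    by (auto intro!: derivative_eq_intros)
  from has_derivative_compose[OF this has_derivative_frechet[OF assms(2)]]
  have "((\<lambda>y. f (y + ?a)) has_derivative frechet_derivative f (at (x + ?a))) (at x)" .
  then have "(f has_derivative frechet_derivative f (at (x + ?a))) (at x)"
    using assms(1) by (simp add: torus_fun_def)
  from partial_eqI[OF this, of i] show "partial i f (x + ?a) = partial i f x"
    by (simp add: partial_def)
qed

lemma torus_fun_laplacian:
  assumes "torus_fun f" "twice_differentiable f"
  shows "torus_fun (laplacian f)"
proof -
  have "torus_fun (partial i (partial i f))" for i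
    using assms by (intro torus_fun_partial) (auto simp: twice_differentiable_def)
  then show ?thesis by (simp add: torus_fun_def laplacian_eq_sum)
qed

text \<open>At a spatial minimum all terms containing a first derivative of \<open>\<theta>\<close>
  vanish, and the second derivatives of \<open>\<theta>\<close> enter with nonnegative coefficients.
  What remains is quadratic in \<open>\<theta>\<close>; one factor is kept apart so that the bound
  reads as a rate times \<open>\<theta>\<close>.\<close>

lemma temperature_growth_at_min:
  fixes \<rho> \<theta> :: "real \<Rightarrow> real^'n \<Rightarrow> real"
  assumes sol: "positive_gas_solution \<kappa>1 \<kappa>2 D T \<rho> \<theta>" and t: "t \<in> {0..<T}"
    and pos: "0 < \<kappa>1" "0 < \<kappa>2" "0 < D"
    and min: "\<And>y. \<theta> t x \<le> \<theta> t y" and nonneg: "0 \<le> \<theta> t x"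
  shows "\<kappa>1\<^sup>2 * \<theta> t x * laplacian (\<rho> t) x / (\<kappa>2 * \<rho> t x) * \<theta> t x \<le> time_deriv T \<theta> t x"
proof -
  have \<rho>: "0 < \<rho> t x" using sol t by (auto simp: positive_gas_solution_def)
  have "smooth_on_torus T \<theta>"
    using sol by (simp add: positive_gas_solution_def ideal_gas_solution_def)
  then have td: "twice_differentiable (\<theta> t)" using smooth_on_torusD(2) t by blast
  note m = spatial_min[of "\<theta> t" x, OF td min]
  have "\<kappa>1\<^sup>2 * (\<theta> t x)\<^sup>2 * laplacian (\<rho> t) x
      = (\<Sum>i\<in>UNIV. \<kappa>1\<^sup>2 * (\<theta> t x)\<^sup>2 * partial i (partial i (\<rho> t)) x)"
    by (simp add: laplacian_eq_sum sum_distrib_left)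
  also have "\<dots> \<le> \<kappa>2 * \<rho> t x * time_deriv T \<theta> t x"
    unfolding gas_evolution(2)[OF sol t]
  proof (rule sum_mono)
    fix i
    have "0 \<le> (\<kappa>1\<^sup>2 + \<kappa>1 * D) * (\<theta> t x * (\<rho> t x * partial i (partial i (\<theta> t)) x))"
      using pos nonneg \<rho> m(2)[of i] by (intro mult_nonneg_nonneg add_nonneg_nonneg) auto
    then show "\<kappa>1\<^sup>2 * (\<theta> t x)\<^sup>2 * partial i (partial i (\<rho> t)) x
      \<le> \<kappa>1\<^sup>2 * \<theta> t x * (partial i (partial i (\<rho> t)) x * \<theta> t x
          + 2 * partial i (\<rho> t) x * partial i (\<theta> t) x + \<rho> t x * partial i (partial i (\<theta> t)) x)
        + \<kappa>1 * (\<kappa>1 + \<kappa>2 + D) * partial i (\<theta> t) x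
          * (partial i (\<rho> t) x * \<theta> t x + \<rho> t x * partial i (\<theta> t) x)
        + \<kappa>1 * D * \<rho> t x * \<theta> t x * partial i (partial i (\<theta> t)) x"
      by (simp add: m(1) algebra_simps power2_eq_square)
  qed
  finally show ?thesis
    using pos \<rho> by (simp add: field_simps power2_eq_square)
qed

lemma temperature_positive:
  fixes \<rho> \<theta> :: "real \<Rightarrow> real^'n \<Rightarrow> real"
  assumes sol: "positive_gas_solution \<kappa>1 \<kappa>2 D T \<rho> \<theta>" and t: "t \<in> {0..<T}"
    and pos: "0 < \<kappa>1" "0 < \<kappa>2" "0 < D"
  shows "0 < \<theta> t x"
proof (rule ccontr)
  assume neg: "\<not> 0 < \<theta> t x"
  have smooth: "smooth_on_torus T \<rho>" "smooth_on_torus T \<theta>"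
    and \<rho>: "\<And>s y. s \<in> {0..<T} \<Longrightarrow> 0 < \<rho> s y" and \<theta>0: "\<And>y. 0 < \<theta> 0 y"
    using sol by (auto simp: positive_gas_solution_def ideal_gas_solution_def)
  have per: "torus_fun (\<rho> s)" "torus_fun (\<theta> s)" if "s \<in> {0..<T}" for s
    using smooth that by (auto simp: smooth_on_torus_def)
  have sub: "{0..b} \<times> A \<subseteq> {0..<T} \<times> UNIV" if "b < T" for b and A :: "(real^'n) set"
    using that by auto
  note cont\<rho> = continuous_on_subset[OF smooth(1)[THEN smooth_on_torusD(1)] sub]
  note cont\<theta> = continuous_on_subset[OF smooth(2)[THEN smooth_on_torusD(1)] sub]
  note contL = continuous_on_subset[OF smooth(1)[THEN smooth_on_torusD(4)] sub]
  \<comment> \<open>The points of one period cell, up to time \<open>t\<close>, where the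
    temperature is not positive. Compactness provides an earliest such time
    \<open>s\<close>.\<close>
  define Z where "Z = ({0..t} \<times> cbox 0 1) \<inter> (\<lambda>(s, y). \<theta> s y) -` {..0}"
  have "closed Z"
    unfolding Z_def using t
    by (intro continuous_closed_preimage cont\<theta> closed_Times closed_cbox closed_atLeastAtMost closed_atMost) auto
  moreover have "bounded Z"
    unfolding Z_def by (intro bounded_Int disjI1 bounded_Times bounded_cbox bounded_closed_interval)
  ultimately have "compact Z" by (simp add: compact_eq_bounded_closed)
  moreover have "(t, \<chi> i. frac (x $ i)) \<in> Z"
    using neg t torus_fun_frac[OF per(2)[OF t], of x] frac_vec_in_cbox[of x] by (auto simp: Z_def)
  ultimately obtain z where "z \<in> Z" and z: "\<And>z'. z' \<in> Z \<Longrightarrow> fst z \<le> fst z'"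
    using continuous_attains_inf[of Z fst] continuous_on_fst[OF continuous_on_id, of Z] by (metis empty_iff)
  define s where "s = fst z"
  have s: "s \<in> {0..t}" "\<theta> s (snd z) \<le> 0" using \<open>z \<in> Z\<close> by (auto simp: Z_def s_def)
  have "s < T" using s t by auto
  have before: "0 < \<theta> r y" if "0 \<le> r" "r < s" for r y
  proof (rule ccontr)
    assume "\<not> 0 < \<theta> r y"
    then have "(r, \<chi> i. frac (y $ i)) \<in> Z"
      using that s(1) torus_fun_frac[OF per(2), of r y] \<open>s < T\<close> frac_vec_in_cbox[of y]
      by (auto simp: Z_def)
    from z[OF this] show False using that by (simp add: s_def)
  qed
  \<comment> \<open>A negative value at time \<open>s\<close> would force a zero at an earlier time,
    by the intermediate value theorem starting from the positive initial value.\<close>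
  have nonneg: "0 \<le> \<theta> r y" if "r \<in> {0..s}" for r y
  proof (rule ccontr)
    assume "\<not> 0 \<le> \<theta> r y"
    then have "r = s" using before[of r y] that by force
    have "continuous_on {0..s} (\<lambda>r. (\<lambda>(r, y). \<theta> r y) (r, y))"
      by (rule continuous_on_compose2[OF cont\<theta>[OF \<open>s < T\<close>, of UNIV]]) (auto intro!: continuous_intros)
    then have "\<exists>r. 0 \<le> r \<and> r \<le> s \<and> \<theta> r y = 0"
      using IVT2'[of "\<lambda>r. \<theta> r y" s 0 0] \<open>\<not> 0 \<le> \<theta> r y\<close> \<open>r = s\<close> \<theta>0[of y] s(1) by auto
    then obtain r' where "0 \<le> r'" "r' \<le> s" "\<theta> r' y = 0" by blast
    then show False
      using before[of r' y] \<open>\<not> 0 \<le> \<theta> r y\<close> \<open>r = s\<close> by (cases "r' = s") auto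
  qed
  have nz: "\<kappa>2 * \<rho> r y \<noteq> 0" if "r \<in> {0..s}" for r y
    using \<rho>[of r y] pos that \<open>s < T\<close> by auto
  \<comment> \<open>The negative of the growth rate at spatial minima; its upper bound
    \<open>K\<close> on \<open>[0, s]\<close> provides the exponential factor below.\<close>
  define F where "F r y = - (\<kappa>1\<^sup>2 * \<theta> r y * laplacian (\<rho> r) y / (\<kappa>2 * \<rho> r y))" for r y
  have "continuous_on ({0..s} \<times> UNIV) (\<lambda>(r, y). F r y)"
    using cont\<rho>[OF \<open>s < T\<close>, of UNIV] cont\<theta>[OF \<open>s < T\<close>, of UNIV] contL[OF \<open>s < T\<close>, of UNIV] pos
    unfolding F_def case_prod_unfold
    by (intro continuous_intros) (use nz in auto)
  moreover have "torus_fun (F r)" if "r \<in> {0..s}" for r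
  proof -
    have r: "r \<in> {0..<T}" using that \<open>s < T\<close> by auto
    show ?thesis
      using per[OF r] torus_fun_laplacian[OF per(1)[OF r] smooth(1)[THEN smooth_on_torusD(2), OF r]]
      by (simp add: torus_fun_def F_def)
  qed
  moreover have "0 \<le> s" using s(1) by simp
  ultimately obtain K where K: "\<And>r y. r \<in> {0..s} \<Longrightarrow> F r y \<le> K"
    using torus_attains_sup[of 0 s F] by metis
  define u where "u r y = - (exp (K * r) * \<theta> r y)" for r y
  define u' where "u' r y = - (exp (K * r) * (K * \<theta> r y + time_deriv T \<theta> r y))" for r y
  have per_u: "torus_fun (u r)" if "r \<in> {0..s}" for r
    using per(2)[of r] that \<open>s < T\<close> by (simp add: torus_fun_def u_def)
  have cont_u: "continuous_on ({0..s} \<times> UNIV) (\<lambda>(r, y). u r y)"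
    using cont\<theta>[OF \<open>s < T\<close>, of UNIV] unfolding u_def case_prod_unfold by (intro continuous_intros)
  have "continuous_on ({0..0} \<times> UNIV) (\<lambda>(r, y). u r y)"
    using s(1) by (intro continuous_on_subset[OF cont_u]) auto
  then obtain a b where "a \<in> {0..0}" "\<And>r y. r \<in> {0..0} \<Longrightarrow> u r y \<le> u a b"
    using torus_attains_sup[of 0 0 u] per_u s(1) by auto
  then have init: "u 0 y \<le> u 0 b" for y by simp
  have "u s (snd z) \<le> u 0 b"
  proof (rule torus_maximum_principle[where u' = u', OF per_u cont_u _ _ init])
    fix r y assume r: "r \<in> {0..s}"
    then have rT: "r \<in> {0..<T}" using \<open>s < T\<close> by auto
    have "((\<lambda>r. \<theta> r y) has_real_derivative time_deriv T \<theta> r y) (at r within {0..s})"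
      by (rule DERIV_subset[OF smooth(2)[THEN smooth_on_torusD(3), OF rT]]) (use \<open>s < T\<close> in auto)
    then show "((\<lambda>r. u r y) has_real_derivative u' r y) (at r within {0..s})"
      unfolding u_def u'_def by (auto intro!: derivative_eq_intros simp: algebra_simps)
    assume "\<And>y'. u r y' \<le> u r y"
    then have "\<theta> r y \<le> \<theta> r y'" for y' by (simp add: u_def)
    then have "- F r y * \<theta> r y \<le> time_deriv T \<theta> r y"
      using temperature_growth_at_min[OF sol rT pos, of y] nonneg[OF r] by (simp add: F_def)
    moreover have "F r y * \<theta> r y \<le> K * \<theta> r y"
      using K[OF r] nonneg[OF r] by (rule mult_right_mono)
    ultimately show "u' r y \<le> 0" by (simp add: u'_def)
  qed (use s(1) in auto)
  \<comment> \<open>The initial maximum of \<open>u\<close> is attained, hence strictly negative; it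
    bounds \<open>u\<close> at time \<open>s\<close>, where the temperature was found to be
    nonpositive.\<close>
  moreover have "u 0 b < 0" using \<theta>0 by (simp add: u_def)
  ultimately have "u s (snd z) < 0" by simp
  then show False using s(2) by (simp add: u_def zero_less_mult_iff)
qed

section \<open>Bounds on the products of density and powers of temperature\<close>

text \<open>
  With \<open>a = ln \<rho>\<close>, \<open>b = ln \<theta>\<close> and \<open>\<nabla>a = - c \<nabla>b\<close>, the root condition turns the second-order part of
  the equation for \<open>a + c b\<close> into a positive multiple of \<open>\<Delta>(a + c b)\<close> and the first-order part
  into \<open>c (1 - c) (\<kappa>1 (1 - c) + D) |\<nabla>b|\<^sup>2\<close>.
\<close>

definition admissible_exponent :: "real \<Rightarrow> real \<Rightarrow> real \<Rightarrow> real \<Rightarrow> bool" where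
  "admissible_exponent \<kappa>1 \<kappa>2 D c \<longleftrightarrow>
     \<kappa>1 * c\<^sup>2 + (\<kappa>2 - \<kappa>1 - D) * c - \<kappa>2 = 0 \<and> 0 < \<kappa>2 + \<kappa>1 * c \<and>
     c * (1 - c) * (\<kappa>1 * (1 - c) + D) \<le> 0"

text \<open>The quadratic is negative at \<open>0\<close> and \<open>1\<close> and positive at
  \<open>1 + D / \<kappa>1\<close> and \<open>- (\<kappa>2 / \<kappa>1)\<close>, with value
  \<open>\<kappa>2 * D / \<kappa>1\<close> at both of the latter. The intermediate value theorem
  places a root in \<open>[1, 1 + D / \<kappa>1]\<close> and one in
  \<open>(- (\<kappa>2 / \<kappa>1), 0)\<close>; these locations give the two sign
  conditions.\<close>

lemma admissible_exponents:
  assumes pos: "0 < \<kappa>1" "0 < \<kappa>2" "0 < D"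
  obtains c1 c2 where "0 < c1" "admissible_exponent \<kappa>1 \<kappa>2 D c1"
    "c2 < 0" "admissible_exponent \<kappa>1 \<kappa>2 D c2"
proof -
  define F where "F c = \<kappa>1 * c\<^sup>2 + (\<kappa>2 - \<kappa>1 - D) * c - \<kappa>2" for c
  have cont: "continuous_on A F" for A unfolding F_def by (intro continuous_intros)
  have "F 1 \<le> 0" "0 \<le> F (1 + D / \<kappa>1)" "F 0 \<le> 0" "0 \<le> F (- (\<kappa>2 / \<kappa>1))" "F 0 < 0" "0 < F (- (\<kappa>2 / \<kappa>1))"
    using pos by (auto simp: F_def field_simps power2_eq_square)
  moreover from this obtain c1 where "1 \<le> c1" "c1 \<le> 1 + D / \<kappa>1" "F c1 = 0"
    using IVT'[of F 1 0 "1 + D / \<kappa>1"] cont pos by auto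
  moreover from calculation obtain c2 where "- (\<kappa>2 / \<kappa>1) \<le> c2" "c2 \<le> 0" "F c2 = 0"
    using IVT2'[of F 0 0 "- (\<kappa>2 / \<kappa>1)"] cont pos by auto
  moreover from calculation have "c2 \<noteq> - (\<kappa>2 / \<kappa>1)" by auto
  ultimately have c1: "1 \<le> c1" "\<kappa>1 * (c1 - 1) \<le> D" "F c1 = 0"
    and c2: "- (\<kappa>2 / \<kappa>1) < c2" "c2 < 0" "F c2 = 0"
    using pos by (auto simp: field_simps less_le)
  have "c1 * (1 - c1) * (\<kappa>1 * (1 - c1) + D) \<le> 0"
    using c1 by (intro mult_nonpos_nonneg mult_nonneg_nonpos) (auto simp: algebra_simps)
  moreover have "c2 * (1 - c2) * (\<kappa>1 * (1 - c2) + D) \<le> 0"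
    using c2 pos by (intro mult_nonpos_nonneg) (auto intro!: add_nonneg_nonneg mult_nonneg_nonneg)
  moreover have "0 < \<kappa>2 + \<kappa>1 * c1" using c1 pos by (intro add_pos_pos mult_pos_pos) auto
  moreover have "0 < \<kappa>2 + \<kappa>1 * c2" using c2 pos by (simp add: field_simps)
  ultimately have "admissible_exponent \<kappa>1 \<kappa>2 D c1" "admissible_exponent \<kappa>1 \<kappa>2 D c2"
    using c1 c2 by (simp_all add: admissible_exponent_def F_def)
  then show ?thesis using that[of c1 c2] c1 c2 by simp
qed

text \<open>The contribution of one coordinate to the time derivative of
  \<open>ln \<rho> + c * ln \<theta>\<close> at a spatial maximum: \<open>f\<close>,
  \<open>g\<close> are the values of density and temperature, \<open>A\<close>, \<open>B\<close>
  their first and \<open>P\<close>, \<open>Q\<close> their second partial derivatives.\<close>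

lemma directional_term_nonpos:
  fixes f g A B P Q :: real
  assumes pos: "0 < \<kappa>1" "0 < \<kappa>2" "0 < f" "0 < g"
    and c: "admissible_exponent \<kappa>1 \<kappa>2 D c"
    and first: "A / f + c * (B / g) = 0"
    and second: "P / f - (A / f)\<^sup>2 + c * (Q / g - (B / g)\<^sup>2) \<le> 0"
  defines "q \<equiv> A * g + f * B" and "q' \<equiv> P * g + 2 * A * B + f * Q"
  shows "\<kappa>1 * q' / f
    + c * (\<kappa>1\<^sup>2 * g * q' + \<kappa>1 * (\<kappa>1 + \<kappa>2 + D) * B * q + \<kappa>1 * D * f * g * Q) / (\<kappa>2 * f * g) \<le> 0"
    (is "?L \<le> 0")
proof -
  \<comment> \<open>Passing to logarithmic derivatives: \<open>b\<close> is the first derivative of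
    \<open>ln \<theta>\<close>, and \<open>a2\<close>, \<open>b2\<close> are the second derivatives
    of \<open>ln \<rho>\<close> and \<open>ln \<theta>\<close>.\<close>
  define b a2 b2 where "b = B / g" and "a2 = P / f - (A / f)\<^sup>2" and "b2 = Q / g - (B / g)\<^sup>2"
  have A: "A = - (f * c * b)" using first pos by (simp add: b_def field_simps)
  have B: "B = g * b" using pos by (simp add: b_def)
  have P: "P = f * (a2 + c\<^sup>2 * b\<^sup>2)"
    using pos by (simp add: a2_def A field_simps power2_eq_square)
  have Q: "Q = g * (b2 + b\<^sup>2)" using pos by (simp add: b2_def B power2_eq_square)
  \<comment> \<open>Replacing \<open>c * D\<close> by this expression makes the coefficient of
    \<open>b2\<close> equal to \<open>c\<close> times that of \<open>a2\<close>, so both combine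
    into \<open>a2 + c * b2\<close>, whose sign is known at the maximum.\<close>
  have root: "c * D = \<kappa>1 * c\<^sup>2 + (\<kappa>2 - \<kappa>1) * c - \<kappa>2"
    using c by (simp add: admissible_exponent_def algebra_simps)
  have q: "q = f * g * ((1 - c) * b)" by (simp add: q_def A B algebra_simps)
  have q': "q' = f * g * (a2 + b2 + (1 - c)\<^sup>2 * b\<^sup>2)"
    by (simp add: q'_def A B P Q algebra_simps power2_eq_square)
  have "?L = \<kappa>1 * g / \<kappa>2 * (\<kappa>2 * (a2 + b2 + (1 - c)\<^sup>2 * b\<^sup>2)
      + c * (\<kappa>1 * (a2 + b2 + (1 - c)\<^sup>2 * b\<^sup>2) + (\<kappa>1 + \<kappa>2 + D) * (1 - c) * b\<^sup>2 + D * (b2 + b\<^sup>2)))"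
    unfolding q q' B Q using pos by (simp add: field_simps power2_eq_square)
  also have "\<dots> = \<kappa>1 * g / \<kappa>2 * ((\<kappa>2 + \<kappa>1 * c) * (a2 + c * b2)
      + c * (1 - c) * (\<kappa>1 * (1 - c) + D) * b\<^sup>2)"
    using root by algebra
  also have "\<dots> \<le> 0"
  proof (rule mult_nonneg_nonpos[OF _ add_nonpos_nonpos])
    show "(\<kappa>2 + \<kappa>1 * c) * (a2 + c * b2) \<le> 0"
      using c second by (intro mult_nonneg_nonpos) (auto simp: admissible_exponent_def a2_def b2_def)
    show "c * (1 - c) * (\<kappa>1 * (1 - c) + D) * b\<^sup>2 \<le> 0"
      using c by (intro mult_nonpos_nonneg[OF _ zero_le_power2]) (simp add: admissible_exponent_def)
  qed (use pos in simp)
  finally show ?thesis .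
qed

lemma log_invariant_bound:
  fixes \<rho> \<theta> :: "real \<Rightarrow> real^'n \<Rightarrow> real"
  assumes sol: "positive_gas_solution \<kappa>1 \<kappa>2 D T \<rho> \<theta>" and t: "t \<in> {0..<T}"
    and pos: "0 < \<kappa>1" "0 < \<kappa>2" "0 < D" and c: "admissible_exponent \<kappa>1 \<kappa>2 D c"
    and init: "\<And>y. ln (\<rho> 0 y) + c * ln (\<theta> 0 y) \<le> m"
  shows "ln (\<rho> t x) + c * ln (\<theta> t x) \<le> m"
proof -
  have smooth: "smooth_on_torus T \<rho>" "smooth_on_torus T \<theta>"
    and \<rho>: "\<And>s y. s \<in> {0..<T} \<Longrightarrow> 0 < \<rho> s y"
    using sol by (auto simp: positive_gas_solution_def ideal_gas_solution_def)
  have \<theta>: "0 < \<theta> s y" if "s \<in> {0..<T}" for s y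
    using temperature_positive[OF sol that pos] .
  have sub: "{0..t} \<subseteq> {0..<T}" using t by auto
  define w where "w s y = ln (\<rho> s y) + c * ln (\<theta> s y)" for s y
  define w' where "w' s y = time_deriv T \<rho> s y / \<rho> s y + c * (time_deriv T \<theta> s y / \<theta> s y)" for s y
  have "w t x \<le> m"
  proof (rule torus_maximum_principle[where u = w and u' = w' and b = t])
    show "torus_fun (w s)" if "s \<in> {0..t}" for s
      using smooth that sub unfolding smooth_on_torus_def torus_fun_def w_def by auto
    have "continuous_on ({0..t} \<times> UNIV) (\<lambda>(s, x). \<rho> s x)" "continuous_on ({0..t} \<times> UNIV) (\<lambda>(s, x). \<theta> s x)"
      using smooth[THEN smooth_on_torusD(1)] sub by (auto elim: continuous_on_subset)
    then show "continuous_on ({0..t} \<times> UNIV) (\<lambda>(s, x). w s x)"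
      unfolding w_def case_prod_unfold
      by (intro continuous_intros) (use \<rho> \<theta> sub in \<open>force simp: less_imp_neq[symmetric]\<close>)+
    show "w 0 y \<le> m" for y using init by (simp add: w_def)
    show "t \<in> {0..t}" using t by simp
    fix s y assume "s \<in> {0..t}"
    then have s: "s \<in> {0..<T}" using sub by blast
    note d = smooth[THEN smooth_on_torusD(3), OF s, THEN DERIV_subset, OF sub, of y]
    show "((\<lambda>s. w s y) has_real_derivative w' s y) (at s within {0..t})"
      unfolding w_def w'_def using \<rho>[OF s, of y] \<theta>[OF s, of y]
      by (auto intro!: derivative_eq_intros d simp: field_simps)
    assume "\<And>y'. w s y' \<le> w s y"
    then have max: "ln (\<rho> s y') + c * ln (\<theta> s y') \<le> ln (\<rho> s y) + c * ln (\<theta> s y)" for y'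
      by (simp add: w_def)
    note crit = spatial_max_ln_add_ln[of "\<rho> s" "\<theta> s" c y, OF
        smooth(1)[THEN smooth_on_torusD(2), OF s] \<rho>[OF s]
        smooth(2)[THEN smooth_on_torusD(2), OF s] \<theta>[OF s] max]
    \<comment> \<open>The temperature term is expanded by \<open>\<kappa>2 * \<rho>\<close> to
      expose the left-hand side of its evolution equation.\<close>
    have "w' s y = time_deriv T \<rho> s y / \<rho> s y
        + c * (\<kappa>2 * \<rho> s y * time_deriv T \<theta> s y) / (\<kappa>2 * \<rho> s y * \<theta> s y)"
      using pos \<rho>[OF s, of y] by (simp add: w'_def)
    also have "\<dots> \<le> 0"
      unfolding gas_evolution[OF sol s] sum_distrib_left sum_divide_distrib sum.distrib[symmetric]
      by (intro sum_nonpos directional_term_nonpos pos \<rho>[OF s] \<theta>[OF s] c crit)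
    finally show "w' s y \<le> 0" .
  qed
  then show ?thesis by (simp add: w_def)
qed

text \<open>The constant is the exponential of the maximum of
  \<open>ln \<rho>0 + c * ln \<theta>0\<close>, so it depends on the initial data but not on the
  solution or its lifespan.\<close>

lemma log_invariant_bound_uniform:
  fixes \<rho>0 \<theta>0 :: "real^'n \<Rightarrow> real"
  assumes pos: "0 < \<kappa>1" "0 < \<kappa>2" "0 < D" and c: "admissible_exponent \<kappa>1 \<kappa>2 D c"
  obtains m where "\<And>T \<rho> \<theta> t x. positive_gas_solution \<kappa>1 \<kappa>2 D T \<rho> \<theta> \<Longrightarrow> \<rho> 0 = \<rho>0 \<Longrightarrow> \<theta> 0 = \<theta>0
    \<Longrightarrow> t \<in> {0..<T} \<Longrightarrow> \<rho> t x \<le> exp m * \<theta> t x powr (- c)"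
\<comment> \<open>The data are arbitrary functions. Any one solution starting from them shows them
  to be continuous, periodic and positive; if there is none, the claim is vacuous.\<close>
proof (cases "\<exists>T \<rho> \<theta>. positive_gas_solution \<kappa>1 \<kappa>2 D T \<rho> \<theta> \<and> \<rho> 0 = \<rho>0 \<and> \<theta> 0 = \<theta>0")
  case False
  then show ?thesis using that by blast
next
  case True
  then obtain T \<rho> \<theta> where sol: "positive_gas_solution \<kappa>1 \<kappa>2 D T \<rho> \<theta>" and init: "\<rho> 0 = \<rho>0" "\<theta> 0 = \<theta>0"
    by blast
  have smooth: "smooth_on_torus T \<rho>" "smooth_on_torus T \<theta>" and T: "0 \<in> {0..<T}"
    and \<rho>: "\<And>y. 0 < \<rho> 0 y" and \<theta>: "\<And>y. 0 < \<theta> 0 y"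
    using sol by (auto simp: positive_gas_solution_def ideal_gas_solution_def)
  define w where "w = (\<lambda>s y. ln (\<rho> s y) + c * ln (\<theta> s y))"
  have "torus_fun (w s)" if "s \<in> {0..0}" for s
    using smooth that T unfolding smooth_on_torus_def torus_fun_def w_def by auto
  moreover have "continuous_on ({0..0} \<times> UNIV) (\<lambda>(s, x). \<rho> s x)" "continuous_on ({0..0} \<times> UNIV) (\<lambda>(s, x). \<theta> s x)"
    using smooth[THEN smooth_on_torusD(1)] T by (auto elim: continuous_on_subset)
  then have "continuous_on ({0..0} \<times> UNIV) (\<lambda>(s, x). w s x)"
    unfolding w_def case_prod_unfold
    by (intro continuous_intros) (use \<rho> \<theta> in \<open>force simp: less_imp_neq[symmetric]\<close>)+
  ultimately obtain s y where "s \<in> {0..0}" "\<And>r z. r \<in> {0..0} \<Longrightarrow> w r z \<le> w s y"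
    using torus_attains_sup[of 0 0 w] by auto
  then have bound: "ln (\<rho>0 z) + c * ln (\<theta>0 z) \<le> w 0 y" for z
    using init by (auto simp: w_def)
  show ?thesis
  proof (rule that[of "w 0 y"])
    fix T \<rho> \<theta> t x
    assume sol: "positive_gas_solution \<kappa>1 \<kappa>2 D T \<rho> \<theta>" and "\<rho> 0 = \<rho>0" "\<theta> 0 = \<theta>0" and t: "t \<in> {0..<T}"
    then have "ln (\<rho> t x) \<le> w 0 y + (- c) * ln (\<theta> t x)"
      using log_invariant_bound[OF sol t pos c, of "w 0 y" x] bound by simp
    moreover have "0 < \<rho> t x" using sol t by (simp add: positive_gas_solution_def)
    moreover have "0 < \<theta> t x" using temperature_positive[OF sol t pos] .
    ultimately show "\<rho> t x \<le> exp (w 0 y) * \<theta> t x powr (- c)"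
      using exp_le_cancel_iff[of "ln (\<rho> t x)"] by (simp add: powr_def flip: exp_add)
  qed
qed

text \<open>The exponents are fixed before the initial data, while \<open>M\<close> and
  \<open>C\<close> may depend on the data but not on \<open>T\<close> or the solution. A factor such
  as \<open>C\<close> is unavoidable, since the constant state with density 2 and temperature 1 is a
  solution. Blow-up and decay are expressed along sequences of space-time points, which may approach
  the final time.\<close>

theorem theorem4p1:
  fixes \<kappa>1 \<kappa>2 D :: real
  assumes "0 < \<kappa>1" and "0 < \<kappa>2" and "0 < D"
  shows
    "(\<forall>T \<rho> \<theta>. positive_gas_solution \<kappa>1 \<kappa>2 D T \<rho> (\<theta> :: real \<Rightarrow> real^'n \<Rightarrow> real) \<longrightarrow>
        (\<forall>t\<in>{0..<T}. \<forall>x. 0 < \<theta> t x))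
     \<and>
     (\<forall>\<rho>0 \<theta>0. \<exists>M. \<forall>T \<rho> \<theta>.
        positive_gas_solution \<kappa>1 \<kappa>2 D T \<rho> (\<theta> :: real \<Rightarrow> real^'n \<Rightarrow> real) \<and>
        \<rho> 0 = \<rho>0 \<and> \<theta> 0 = \<theta>0 \<longrightarrow>
        (\<forall>t\<in>{0..<T}. \<forall>x. \<rho> t x \<le> M))
     \<and>
     (\<forall>T \<rho> \<theta>. positive_gas_solution \<kappa>1 \<kappa>2 D T \<rho> (\<theta> :: real \<Rightarrow> real^'n \<Rightarrow> real) \<longrightarrow>
        (\<forall>t x. (\<forall>k::nat. t k \<in> {0..<T}) \<and>
           (filterlim (\<lambda>k. \<theta> (t k) (x k)) at_top sequentially \<or>
            (\<lambda>k. \<theta> (t k) (x k)) \<longlonglongrightarrow> 0) \<longrightarrow>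
           (\<lambda>k. \<rho> (t k) (x k)) \<longlonglongrightarrow> 0))
     \<and>
     (\<exists>c1>0. \<exists>c2<0. \<forall>\<rho>0 \<theta>0. \<exists>C>0. \<forall>T \<rho> \<theta>.
        positive_gas_solution \<kappa>1 \<kappa>2 D T \<rho> (\<theta> :: real \<Rightarrow> real^'n \<Rightarrow> real) \<and>
        \<rho> 0 = \<rho>0 \<and> \<theta> 0 = \<theta>0 \<longrightarrow>
        (\<forall>t\<in>{0..<T}. \<forall>x.
           \<rho> t x \<le> C * min (\<theta> t x powr (- c1)) (\<theta> t x powr (- c2))))"
proof -
  note pos = assms
  obtain c1 c2 where c1: "0 < c1" "admissible_exponent \<kappa>1 \<kappa>2 D c1"
    and c2: "c2 < 0" "admissible_exponent \<kappa>1 \<kappa>2 D c2"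
    using admissible_exponents[OF pos] by blast
  have bound: "\<exists>C>0. \<forall>T \<rho> \<theta>.
      positive_gas_solution \<kappa>1 \<kappa>2 D T \<rho> (\<theta> :: real \<Rightarrow> real^'n \<Rightarrow> real) \<and> \<rho> 0 = \<rho>0 \<and> \<theta> 0 = \<theta>0 \<longrightarrow>
      (\<forall>t\<in>{0..<T}. \<forall>x. \<rho> t x \<le> C * min (\<theta> t x powr (- c1)) (\<theta> t x powr (- c2)))" for \<rho>0 \<theta>0
  proof -
    obtain m1 where m1: "\<And>T \<rho> \<theta> t x. positive_gas_solution \<kappa>1 \<kappa>2 D T \<rho> \<theta> \<Longrightarrow> \<rho> 0 = \<rho>0 \<Longrightarrow> \<theta> 0 = \<theta>0
        \<Longrightarrow> t \<in> {0..<T} \<Longrightarrow> \<rho> t x \<le> exp m1 * \<theta> t x powr (- c1)"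
      using log_invariant_bound_uniform[OF pos c1(2), of \<rho>0 \<theta>0] by blast
    obtain m2 where m2: "\<And>T \<rho> \<theta> t x. positive_gas_solution \<kappa>1 \<kappa>2 D T \<rho> \<theta> \<Longrightarrow> \<rho> 0 = \<rho>0 \<Longrightarrow> \<theta> 0 = \<theta>0
        \<Longrightarrow> t \<in> {0..<T} \<Longrightarrow> \<rho> t x \<le> exp m2 * \<theta> t x powr (- c2)"
      using log_invariant_bound_uniform[OF pos c2(2), of \<rho>0 \<theta>0] by blast
    \<comment> \<open>One constant that dominates those of both exponents, so that the two bounds
      merge into a minimum.\<close>
    define C where "C = exp (max m1 m2)"
    have "exp m1 * a \<le> C * a" "exp m2 * a \<le> C * a" if "0 \<le> a" for a
      using that by (auto simp: C_def intro!: mult_right_mono)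
    then have "\<rho> t x \<le> C * min (\<theta> t x powr (- c1)) (\<theta> t x powr (- c2))"
      if "positive_gas_solution \<kappa>1 \<kappa>2 D T \<rho> \<theta>" "\<rho> 0 = \<rho>0" "\<theta> 0 = \<theta>0" "t \<in> {0..<T}" for T \<rho> \<theta> t x
      using order_trans[OF m1[OF that]] order_trans[OF m2[OF that]] by (simp add: min_def)
    moreover have "0 < C" by (simp add: C_def)
    ultimately show ?thesis by blast
  qed
  have density: "\<exists>M. \<forall>T \<rho> \<theta>.
      positive_gas_solution \<kappa>1 \<kappa>2 D T \<rho> (\<theta> :: real \<Rightarrow> real^'n \<Rightarrow> real) \<and> \<rho> 0 = \<rho>0 \<and> \<theta> 0 = \<theta>0 \<longrightarrow>
      (\<forall>t\<in>{0..<T}. \<forall>x. \<rho> t x \<le> M)" for \<rho>0 \<theta>0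
  proof -
    obtain C where "0 < C" and C: "\<And>T \<rho> \<theta> t x. positive_gas_solution \<kappa>1 \<kappa>2 D T \<rho> \<theta> \<Longrightarrow> \<rho> 0 = \<rho>0
        \<Longrightarrow> \<theta> 0 = \<theta>0 \<Longrightarrow> t \<in> {0..<T}
        \<Longrightarrow> \<rho> t x \<le> C * min (\<theta> t x powr (- c1)) (\<theta> t x powr (- c2))"
      using bound[of \<rho>0 \<theta>0] by blast
    have "\<rho> t x \<le> C"
      if sol: "positive_gas_solution \<kappa>1 \<kappa>2 D T \<rho> \<theta>" and init: "\<rho> 0 = \<rho>0" "\<theta> 0 = \<theta>0"
        and t: "t \<in> {0..<T}" for T \<rho> \<theta> t x
    proof -
      have "0 < \<theta> t x" using temperature_positive[OF sol t pos] .
      \<comment> \<open>On either side of temperature 1 one of the two powers is at most 1: the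
        negative exponent \<open>- c1\<close> above it, the positive exponent \<open>- c2\<close>
        below it.\<close>
      have "min (\<theta> t x powr (- c1)) (\<theta> t x powr (- c2)) \<le> 1"
      proof (cases "1 \<le> \<theta> t x")
        case True
        then have "\<theta> t x powr (- c1) \<le> \<theta> t x powr 0" using c1 by (intro powr_mono) auto
        then show ?thesis using True by simp
      next
        case False
        then have "\<theta> t x powr (- c2) \<le> 1 powr (- c2)"
          using c2 \<open>0 < \<theta> t x\<close> by (intro powr_mono2) auto
        then show ?thesis by simp
      qed
      then have "C * min (\<theta> t x powr (- c1)) (\<theta> t x powr (- c2)) \<le> C"
        using \<open>0 < C\<close> by (simp add: mult_left_le)
      then show ?thesis using C[OF sol init t, of x] by linarith
    qed
    then show ?thesis by blast
  qed
  have vanishing: "(\<lambda>k. \<rho> (t k) (x k)) \<longlonglongrightarrow> 0"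
    if sol: "positive_gas_solution \<kappa>1 \<kappa>2 D T \<rho> (\<theta> :: real \<Rightarrow> real^'n \<Rightarrow> real)"
      and t: "\<And>k::nat. t k \<in> {0..<T}"
      and lim: "filterlim (\<lambda>k. \<theta> (t k) (x k)) at_top sequentially \<or> (\<lambda>k. \<theta> (t k) (x k)) \<longlonglongrightarrow> 0"
    for T \<rho> \<theta> t x
  proof -
    obtain C where "0 < C" and "\<forall>T' \<rho>' \<theta>'.
        positive_gas_solution \<kappa>1 \<kappa>2 D T' \<rho>' \<theta>' \<and> \<rho>' 0 = \<rho> 0 \<and> \<theta>' 0 = \<theta> 0 \<longrightarrow>
        (\<forall>t\<in>{0..<T'}. \<forall>x. \<rho>' t x \<le> C * min (\<theta>' t x powr (- c1)) (\<theta>' t x powr (- c2)))"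
      using bound[of "\<rho> 0" "\<theta> 0"] by (elim exE conjE)
    from this(2)[rule_format, OF conjI[OF sol conjI[OF refl refl]]]
    have C: "\<rho> t x \<le> C * min (\<theta> t x powr (- c1)) (\<theta> t x powr (- c2))" if "t \<in> {0..<T}" for t x
      using that .
    \<comment> \<open>Blow-up is handled by the negative exponent \<open>- c1\<close>, decay to zero
      by the positive exponent \<open>- c2\<close>; the density is then squeezed to zero.\<close>
    have "\<exists>c. (\<lambda>k. \<theta> (t k) (x k) powr c) \<longlonglongrightarrow> 0 \<and> (c = - c1 \<or> c = - c2)"
      using lim
    proof
      assume "filterlim (\<lambda>k. \<theta> (t k) (x k)) at_top sequentially"
      then have "(\<lambda>k. \<theta> (t k) (x k) powr (- c1)) \<longlonglongrightarrow> 0"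
        using c1 by (intro tendsto_neg_powr) auto
      then show ?thesis by blast
    next
      assume "(\<lambda>k. \<theta> (t k) (x k)) \<longlonglongrightarrow> 0"
      then have "(\<lambda>k. \<theta> (t k) (x k) powr (- c2)) \<longlonglongrightarrow> 0"
        using c2 temperature_positive[OF sol t pos]
        by (intro tendsto_zero_powrI[OF _ tendsto_const]) (auto intro: always_eventually less_imp_le)
      then show ?thesis by blast
    qed
    then obtain c where c: "(\<lambda>k. \<theta> (t k) (x k) powr c) \<longlonglongrightarrow> 0" "c = - c1 \<or> c = - c2" by blast
    have upper: "\<rho> (t k) (x k) \<le> C * \<theta> (t k) (x k) powr c" for k
      using c(2) order_trans[OF C[OF t] mult_left_mono] \<open>0 < C\<close> by (meson less_imp_le
          min.cobounded1 min.cobounded2)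
    have lower: "0 \<le> \<rho> (t k) (x k)" for k
      using sol t by (simp add: positive_gas_solution_def less_imp_le)
    have "(\<lambda>k. C * \<theta> (t k) (x k) powr c) \<longlonglongrightarrow> 0"
      using tendsto_mult_left[OF c(1), of C] by simp
    from tendsto_sandwich[OF _ _ tendsto_const this] show ?thesis
      by (simp add: upper lower)
  qed
  show ?thesis
  proof (intro conjI, goal_cases)
    case 1
    show ?case by (intro allI impI ballI temperature_positive[OF _ _ pos])
  next
    case 2
    show ?case by (intro allI density)
  next
    case 3
    show ?case by (intro allI impI, elim conjE) (erule vanishing, simp)
  next
    case 4
    show ?case
      by (rule exI[of _ c1], rule conjI[OF c1(1)], rule exI[of _ c2], rule conjI[OF c2(1)])
        (intro allI bound)
  qed
qed

end
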